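(* Let $X,Y\in\mathbb{R}^{m\times n}$ and let $X$ have full row rank. Let $XX^T=R_x^TR_x$ be the Cholesky factorization, with $R_x\in\mathbb{R}^{m\times m}$ upper triangular with positive diagonal, and let $A=YX^\dagger=(YX^T)(XX^T)^{-1}$. Let $x_{new},y_{new}\in\mathbb{R}^m$, $X_{new}=(X\;\;x_{new})$, $Y_{new}=(Y\;\;y_{new})$. Then $A_{new}=Y_{new}X_{new}^\dagger$ satisfies $$A_{new}=A+\gamma\,(y_{new}-Ax_{new})p_x^T,\qquad p_x=R_x^{-1}(R_x^{-T}x_{new}),\qquad \gamma=\frac{1}{1+x_{new}^Tp_x}.$$ Moreover, there is a product $U_G=G_m\cdots G_2G_1$ of Givens rotation matrices of order $m+1$, with $G_i$ acting on the coordinates $i$ and $m+1$, such that $$U_G\begin{pmatrix}R_x\\ x_{new}^T\end{pmatrix}=\begin{pmatrix}R_{x,new}\\ \mathbf{0}\end{pmatrix},\qquad\text{i.e.}\qquad R_{x,new}=U_G(1:m,1:m+1)\begin{pmatrix}R_x\\ x_{new}^T\end{pmatrix},$$ where $R_{x,new}$ is the updated Cholesky factor, that is, it is upper triangular with positive diagonal and $X_{new}X_{new}^T=R_{x,new}^TR_{x,new}$.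
   Context: $M^\dagger$ denotes the Moore–Penrose pseudoinverse. $U(1:m,1:m+1)$ denotes the submatrix of $U$ formed by rows $1,\dots,m$ and columns $1,\dots,m+1$. A Givens rotation matrix is a plane rotation acting on two coordinates. *)

theory Defs
  imports
    Complex_Main
    Jordan_Normal_Form.Gauss_Jordan_Elimination
    Jordan_Normal_Form.DL_Rank
    Jordan_Normal_Form.DL_Submatrix
begin

text \<open>The four Penrose conditions characterizing the Moore--Penrose pseudoinverse of a real matrix.\<close>

definition is_pinverse :: "real mat \<Rightarrow> real mat \<Rightarrow> bool" where
  "is_pinverse M P \<longleftrightarrow>
     P \<in> carrier_mat (dim_col M) (dim_row M) \<and>
     M * P * M = M \<and>
     P * M * P = P \<and>
     transpose_mat (M * P) = M * P \<and>
     transpose_mat (P * M) = P * M"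

definition pinverse :: "real mat \<Rightarrow> real mat" where
  "pinverse M = (THE P. is_pinverse M P)"

lemma is_pinverse_unique:
  assumes P: "is_pinverse M P" and Q: "is_pinverse M Q"
  shows "P = Q"
proof -
  obtain m n where M: "M \<in> carrier_mat m n" by auto
  have Pc: "P \<in> carrier_mat n m" and Qc: "Q \<in> carrier_mat n m"
    using P Q M unfolding is_pinverse_def by auto
  have P1: "M * P * M = M" and P2: "P * M * P = P"
    and P3: "transpose_mat (M * P) = M * P" and P4: "transpose_mat (P * M) = P * M"
    using P unfolding is_pinverse_def by auto
  have Q1: "M * Q * M = M" and Q2: "Q * M * Q = Q"
    and Q3: "transpose_mat (M * Q) = M * Q" and Q4: "transpose_mat (Q * M) = Q * M"
    using Q unfolding is_pinverse_def by auto
  have MP: "M * P \<in> carrier_mat m m" and MQ: "M * Q \<in> carrier_mat m m"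
    and PM: "P * M \<in> carrier_mat n n" and QM: "Q * M \<in> carrier_mat n n"
    using M Pc Qc by auto
  have "M * P = (M * Q) * (M * P)"
    using assoc_mult_mat[OF MQ M Pc] Q1 by simp
  then have "transpose_mat (M * P) = transpose_mat (M * P) * transpose_mat (M * Q)"
    using transpose_mult[OF MQ MP] by simp
  then have "M * P = (M * P) * (M * Q)" unfolding P3 Q3 .
  also have "\<dots> = M * Q" using assoc_mult_mat[OF MP M Qc] P1 by simp
  finally have e1: "M * P = M * Q" .
  have "P * M = (P * M) * (Q * M)"
    using assoc_mult_mat[OF Pc M QM] assoc_mult_mat[OF M Qc M] Q1 by simp
  then have "transpose_mat (P * M) = transpose_mat (Q * M) * transpose_mat (P * M)"
    using transpose_mult[OF PM QM] by simp
  then have "P * M = (Q * M) * (P * M)" unfolding P4 Q4 .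
  also have "\<dots> = Q * M"
    using assoc_mult_mat[OF Qc M PM] assoc_mult_mat[OF M Pc M] P1 by simp
  finally have e2: "P * M = Q * M" .
  have "P = (P * M) * P" using P2 by simp
  also have "\<dots> = Q * (M * P)" unfolding e2 using assoc_mult_mat[OF Qc M Pc] by simp
  also have "\<dots> = Q * M * Q" unfolding e1 using assoc_mult_mat[OF Qc M Qc] by simp
  finally show ?thesis using Q2 by simp
qed

text \<open>The matrix inverse; meaningful only for invertible \<open>M\<close>.\<close>

definition minv :: "real mat \<Rightarrow> real mat" where
  "minv M = the (mat_inverse M)"

definition is_cholesky :: "nat \<Rightarrow> real mat \<Rightarrow> real mat \<Rightarrow> bool" where
  "is_cholesky m S R \<longleftrightarrow>
     R \<in> carrier_mat m m \<and> upper_triangular R \<and> (\<forall>i<m. 0 < R $$ (i, i)) \<and>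
     S = transpose_mat R * R"

definition append_col :: "real mat \<Rightarrow> real vec \<Rightarrow> real mat" where
  "append_col X x = mat_of_cols (dim_row X) (cols X @ [x])"

text \<open>Rotation by the angle \<open>t\<close> in the plane of the (0-based) coordinates \<open>i \<noteq> j\<close>;
  the opposite orientation convention amounts to replacing \<open>t\<close> by \<open>-t\<close>.\<close>

definition givens_rotation :: "nat \<Rightarrow> nat \<Rightarrow> nat \<Rightarrow> real \<Rightarrow> real mat" where
  "givens_rotation N i j t = mat N N (\<lambda>(a, b).
     if a = b then (if a = i \<or> a = j then cos t else 1)
     else if a = i \<and> b = j then sin t
     else if a = j \<and> b = i then - sin t
     else 0)"

text \<open>\<open>left_prod N G k = G (k - 1) * \<dots> * G 1 * G 0\<close> for matrices of order \<open>N\<close>.\<close>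

primrec left_prod :: "nat \<Rightarrow> (nat \<Rightarrow> real mat) \<Rightarrow> nat \<Rightarrow> real mat" where
  "left_prod N G 0 = 1\<^sub>m N"
| "left_prod N G (Suc k) = G k * left_prod N G k"

end

(* The Cholesky factor is invertible, so X X^T is too, X^T (X X^T)^-1 satisfies the Penrose
   conditions, and A is the solution of A (X X^T) = Y X^T.  Appending a column adds a rank-one
   term to both sides; since (X X^T) p = x for p = (X X^T)^-1 x, the updated A solves the new
   equation.  For the factor, orthogonal U leave W^T W unchanged, where W is R with the row x^T
   appended, and the i-th rotation clears the i-th entry of the last row without filling in
   earlier columns.  Invertibility of the new Gram matrix is read off the new factor. *)

theory Submission
  imports Defs
begin

section \<open>Inverses and pseudoinverses\<close>

text \<open>Since \<open>det M * det B = 1\<close>, \<open>M\<close> is a unit of the matrix ring,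
  so \<open>mat_inverse M\<close> is a \<open>Some\<close> and \<open>the\<close> returns a genuine
  inverse. Uniqueness of inverses then identifies it with \<open>B\<close>, and \<open>minv\<close>
  can be replaced by any inverse already at hand.\<close>

lemma minv_eqI:
  assumes "M \<in> carrier_mat n n" "B \<in> carrier_mat n n" "M * B = 1\<^sub>m n"
  shows "minv M = B"
proof -
  have BM: "B * M = 1\<^sub>m n"
    using mat_mult_left_right_inverse[OF assms] .
  have "det M * det B = 1" using det_mult[OF assms(1,2)] assms(3) by simp
  then have "M \<in> Units (ring_mat TYPE(real) n ())"
    by (intro det_non_zero_imp_unit[OF assms(1)]) auto
  then obtain C where C: "mat_inverse M = Some C"
    using mat_inverse(1)[OF assms(1), where b = "()"] by (cases "mat_inverse M") auto
  have CM: "C * M = 1\<^sub>m n" and Cc: "C \<in> carrier_mat n n"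
    using mat_inverse(2)[OF assms(1) C] by auto
  have "C = C * (M * B)" using Cc assms(3) by simp
  also have "\<dots> = C * M * B" using assoc_mult_mat[OF Cc assms(1,2)] by simp
  also have "\<dots> = B" using assms(2) by (simp add: CM)
  finally show ?thesis by (simp add: minv_def C)
qed

lemma invertible_matI:
  fixes M :: "real mat"
  assumes "M \<in> carrier_mat n n" "B \<in> carrier_mat n n" "M * B = 1\<^sub>m n"
  shows "invertible_mat M"
  using assms mat_mult_left_right_inverse[OF assms]
  unfolding invertible_mat_def inverts_mat_def by auto

lemma pinverse_eqI: "is_pinverse M P \<Longrightarrow> pinverse M = P"
  unfolding pinverse_def by (blast intro: is_pinverse_unique)

text \<open>The determinant of a triangular matrix is the product of its diagonal entries, here all
  positive.\<close>

lemma cholesky_inverse: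
  assumes "is_cholesky m S R"
  obtains B where "B \<in> carrier_mat m m" "R * B = 1\<^sub>m m" "B * R = 1\<^sub>m m"
proof -
  have R: "R \<in> carrier_mat m m" "upper_triangular R" "\<And>i. i < m \<Longrightarrow> 0 < R $$ (i, i)"
    using assms by (auto simp: is_cholesky_def)
  have "0 \<notin> set (diag_mat R)"
    using R(1) R(3) by (fastforce simp: diag_mat_def)
  then have "det R \<noteq> 0"
    by (simp add: det_upper_triangular[OF R(2,1)] prod_list_zero_iff)
  from det_non_zero_imp_unit[OF R(1) this, of "()"] show ?thesis
    using that by (auto simp: Units_def ring_mat_def)
qed

text \<open>With B = R^-1 this is S^-1 = R^-1 R^-T: in R^T (R B) B^T the middle product is the
  identity, and R^T B^T = (B R)^T.\<close>

lemma cholesky_gram_inverse: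
  assumes "is_cholesky m S R" "B \<in> carrier_mat m m" "R * B = 1\<^sub>m m"
  shows "S * (B * transpose_mat B) = 1\<^sub>m m"
proof -
  have R: "R \<in> carrier_mat m m" and S: "S = transpose_mat R * R"
    using assms by (auto simp: is_cholesky_def)
  have BR: "B * R = 1\<^sub>m m"
    using mat_mult_left_right_inverse[OF R assms(2,3)] .
  have "S * (B * transpose_mat B) = transpose_mat R * (R * B * transpose_mat B)"
    using R assms(2) unfolding S
    by (simp add: assoc_mult_mat[where n\<^sub>1=m and n\<^sub>2=m and n\<^sub>3=m and n\<^sub>4=m])
  also have "\<dots> = transpose_mat (B * R)"
    using R assms(2) by (simp add: assms(3) transpose_mult)
  finally show ?thesis by (simp add: BR)
qed

text \<open>The candidate P is a right inverse of X, so every Penrose condition except the symmetry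
  of P X is immediate. That one reads (X^T B X)^T = X^T B X and follows from the symmetry of
  B.\<close>

lemma pinverse_full_row_rank:
  assumes X: "X \<in> carrier_mat m n" and B: "B \<in> carrier_mat m m"
    and inv: "X * transpose_mat X * B = 1\<^sub>m m"
  shows "pinverse X = transpose_mat X * B"
proof (rule pinverse_eqI)
  let ?S = "X * transpose_mat X"
  have S: "?S \<in> carrier_mat m m" and XT: "transpose_mat X \<in> carrier_mat n m" using X by auto
  have BS: "B * ?S = 1\<^sub>m m"
    using mat_mult_left_right_inverse[OF S B inv] .
  have ST: "transpose_mat ?S = ?S" using X by (simp add: transpose_mult)
  \<comment> \<open>The inverse of the symmetric \<open>?S\<close> is symmetric: B^T = B^T (S B) =
    (S B)^T B = B.\<close>
  have "transpose_mat B = transpose_mat B * (?S * B)" using B inv by simp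
  also have "\<dots> = transpose_mat (?S * B) * B"
    using B S by (simp add: transpose_mult ST)
  finally have BT: "transpose_mat B = B" using inv B by simp
  have P: "transpose_mat X * B \<in> carrier_mat n m" using X B by auto
  have XP: "X * (transpose_mat X * B) = 1\<^sub>m m"
    using inv assoc_mult_mat[OF X XT B] by simp
  have PXP: "transpose_mat X * B * X * (transpose_mat X * B) = transpose_mat X * B"
    using XP assoc_mult_mat[OF P X P] right_mult_one_mat[OF P] by simp
  have "transpose_mat (transpose_mat X * B * X) = transpose_mat X * (B * X)"
    using transpose_mult[OF P X] transpose_mult[OF XT B] BT by simp
  then show "is_pinverse X (transpose_mat X * B)"
    using X P B XP PXP unfolding is_pinverse_def by (auto simp: assoc_mult_mat[OF XT B X])
qed

section \<open>Appended rows and columns\<close>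

lemma mult_mat_index_sum:
  assumes "A \<in> carrier_mat r n" "B \<in> carrier_mat n c" "i < r" "j < c"
  shows "(A * B) $$ (i, j) = (\<Sum>k<n. A $$ (i, k) * B $$ (k, j))"
  using assms by (simp add: scalar_prod_def atLeast0LessThan)

lemma append_rows_index:
  assumes "A \<in> carrier_mat r\<^sub>1 c" "B \<in> carrier_mat r\<^sub>2 c" "i < r\<^sub>1 + r\<^sub>2" "j < c"
  shows "(A @\<^sub>r B) $$ (i, j) = (if i < r\<^sub>1 then A $$ (i, j) else B $$ (i - r\<^sub>1, j))"
  using assms by (auto simp: append_rows_def)

text \<open>The summation index of the product runs over the stacked rows, and the sum splits at
  \<open>r\<^sub>1\<close>. This block identity yields both the Gram matrix of a factor with a row
  appended and the products of matrices with a column appended.\<close>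

lemma transpose_append_rows_mult:
  fixes A B C D :: "real mat"
  assumes A: "A \<in> carrier_mat r\<^sub>1 c" and B: "B \<in> carrier_mat r\<^sub>2 c"
    and C: "C \<in> carrier_mat r\<^sub>1 d" and D: "D \<in> carrier_mat r\<^sub>2 d"
  shows "transpose_mat (A @\<^sub>r B) * (C @\<^sub>r D) = transpose_mat A * C + transpose_mat B * D"
    (is "?L = ?R")
proof (rule eq_matI)
  have c: "A @\<^sub>r B \<in> carrier_mat (r\<^sub>1 + r\<^sub>2) c" "C @\<^sub>r D \<in> carrier_mat (r\<^sub>1 + r\<^sub>2) d"
    using carrier_append_rows[OF A B] carrier_append_rows[OF C D] .
  show "dim_row ?L = dim_row ?R" "dim_col ?L = dim_col ?R"
    using c[THEN carrier_matD(2)] assms[THEN carrier_matD(2)] by simp_all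
  fix i j assume "i < dim_row ?R" "j < dim_col ?R"
  then have ij: "i < c" "j < d" using assms by auto
  have "?L $$ (i, j) = (\<Sum>k<r\<^sub>1 + r\<^sub>2. (A @\<^sub>r B) $$ (k, i) * (C @\<^sub>r D) $$ (k, j))"
    using carrier_matD[OF c(1)] ij
    by (subst mult_mat_index_sum[OF transpose_carrier_mat[THEN iffD2, OF c(1)] c(2)]) simp_all
  also have "\<dots> = (\<Sum>k<r\<^sub>1. (A @\<^sub>r B) $$ (k, i) * (C @\<^sub>r D) $$ (k, j))
      + (\<Sum>k<r\<^sub>2. (A @\<^sub>r B) $$ (r\<^sub>1 + k, i) * (C @\<^sub>r D) $$ (r\<^sub>1 + k, j))"
    by (induction r\<^sub>2) (auto simp: add.assoc)
  also have "\<dots> = (\<Sum>k<r\<^sub>1. A $$ (k, i) * C $$ (k, j)) + (\<Sum>k<r\<^sub>2. B $$ (k, i) * D $$ (k, j))"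
    using ij by (simp add: append_rows_index[OF A B] append_rows_index[OF C D])
  also have "\<dots> = ?R $$ (i, j)"
    using assms ij by (simp add: scalar_prod_def atLeast0LessThan)
  finally show "?L $$ (i, j) = ?R $$ (i, j)" .
qed

lemma transpose_mat_of_row:
  "v \<in> carrier_vec m \<Longrightarrow> transpose_mat (mat_of_row v) = mat_of_cols m [v]"
  by (rule eq_matI) (auto simp: mat_of_cols_index)

text \<open>Reduces appended columns to appended rows, so that the block identity for stacked rows
  applies.\<close>

lemma append_col_eq:
  assumes "X \<in> carrier_mat m n" "x \<in> carrier_vec m"
  shows "append_col X x = transpose_mat (transpose_mat X @\<^sub>r mat_of_row x)"
proof -
  have "transpose_mat X \<in> carrier_mat n m" "mat_of_row x \<in> carrier_mat 1 m"
    using assms by auto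
  note ind = append_rows_index[OF this] and car = carrier_append_rows[OF this]
  show ?thesis
  proof (rule eq_matI)
    let ?R = "transpose_mat (transpose_mat X @\<^sub>r mat_of_row x)"
    show "dim_row (append_col X x) = dim_row ?R" "dim_col (append_col X x) = dim_col ?R"
      using assms carrier_matD[OF car] by (simp_all add: append_col_def)
    fix i j assume "i < dim_row ?R" "j < dim_col ?R"
    then have ij: "i < m" "j < n + 1" using carrier_matD[OF car] by simp_all
    then have "?R $$ (i, j) = (transpose_mat X @\<^sub>r mat_of_row x) $$ (j, i)"
      using carrier_matD[OF car] by simp
    also have "\<dots> = append_col X x $$ (i, j)"
      unfolding ind[OF ij(2,1)] using ij assms
      by (cases "j < n") (simp_all add: append_col_def mat_of_cols_index nth_append)
    finally show "append_col X x $$ (i, j) = ?R $$ (i, j)" by (rule sym)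
  qed
qed

text \<open>Serves twice: for the new Gram matrix, with both factors built from X, and for the new
  right-hand side, with Y on the left and X on the right.\<close>

lemma append_col_mult_transpose:
  assumes X: "X \<in> carrier_mat m n" "x \<in> carrier_vec m"
    and Y: "Y \<in> carrier_mat m' n" "y \<in> carrier_vec m'"
  shows "append_col X x * transpose_mat (append_col Y y)
    = X * transpose_mat Y + mat_of_cols m [x] * mat_of_row y"
  using transpose_append_rows_mult[of "transpose_mat X" n m "mat_of_row x" 1
      "transpose_mat Y" m' "mat_of_row y"] assms
  by (simp add: append_col_eq[OF X] append_col_eq[OF Y] transpose_mat_of_row[OF X(2)])

text \<open>\<open>submatrix\<close> addresses the selected rows and columns through
  \<open>pick\<close>, which is the identity on an initial segment. Keeping the leading rows of U
  and all its columns therefore keeps the leading rows of the product.\<close>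

lemma submatrix_leading_mult_index:
  assumes U: "U \<in> carrier_mat N N'" and W: "W \<in> carrier_mat N' c"
    and k: "k \<le> N" and i: "i < k" and j: "j < c"
  shows "(submatrix U {..<k} {..<N'} * W) $$ (i, j) = (U * W) $$ (i, j)"
proof -
  have pick: "pick {..<l} a = a" if "a < l" for a l
  proof -
    \<comment> \<open>Exactly \<open>a\<close> elements of the segment lie below \<open>a\<close>,
      so \<open>a\<close> is the element that \<open>pick\<close> finds at position
      \<open>a\<close>.\<close>
    have "{b \<in> {..<l}. b < a} = {..<a}" using that by auto
    then show ?thesis using pick_card_in_set[of a "{..<l}"] that by simp
  qed
  have "{a. a < N \<and> a \<in> {..<k}} = {..<k}" "{a. a < N' \<and> a \<in> {..<N'}} = {..<N'}"
    using k by auto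
  then have card: "card {a. a < dim_row U \<and> a \<in> {..<k}} = k"
    "card {a. a < dim_col U \<and> a \<in> {..<N'}} = N'"
    using U by simp_all
  have sub: "submatrix U {..<k} {..<N'} \<in> carrier_mat k N'"
    using card by (intro carrier_matI) (simp_all only: dim_submatrix)
  have "submatrix U {..<k} {..<N'} $$ (i, b) = U $$ (i, b)" if "b < N'" for b
    using submatrix_index[of i U "{..<k}" b "{..<N'}", unfolded card, OF i that]
    by (simp only: pick i that)
  then show ?thesis
    using i j k by (simp add: mult_mat_index_sum[OF sub W] mult_mat_index_sum[OF U W])
qed

section \<open>Givens rotations\<close>

lemma givens_carrier [simp]: "givens_rotation N i j t \<in> carrier_mat N N"
  by (simp add: givens_rotation_def)

lemma givens_mult_index:
  assumes W: "W \<in> carrier_mat N c" and ij: "i < N" "j < N" "i \<noteq> j" and ab: "a < N" "b < c"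
  shows "(givens_rotation N i j t * W) $$ (a, b) =
    (if a = i then cos t * W $$ (i, b) + sin t * W $$ (j, b)
     else if a = j then cos t * W $$ (j, b) - sin t * W $$ (i, b)
     else W $$ (a, b))"
proof -
  have "(givens_rotation N i j t * W) $$ (a, b)
      = (\<Sum>k<N. givens_rotation N i j t $$ (a, k) * W $$ (k, b))"
    by (rule mult_mat_index_sum[OF givens_carrier W ab])
  \<comment> \<open>Row \<open>a\<close> of the rotation is written as three one-point
    contributions, at \<open>k = i\<close>, \<open>k = j\<close> and \<open>k = a\<close>, the last
    switched off when \<open>a\<close> is one of the rotated coordinates. Each of the three sums
    then collapses to a single term.\<close>
  also have "\<dots> = (\<Sum>k<N.
      (if k = i then (if a = i then cos t else if a = j then - sin t else 0) * W $$ (k, b) else 0)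
    + (if k = j then (if a = i then sin t else if a = j then cos t else 0) * W $$ (k, b) else 0)
    + (if k = a then (if a = i \<or> a = j then 0 else 1) * W $$ (k, b) else 0))"
    by (rule sum.cong) (use ij ab in \<open>auto simp: givens_rotation_def\<close>)
  finally show ?thesis
    using ij ab by (simp add: sum.distrib)
qed

text \<open>Transposing a rotation reverses its angle. The row formula for a product then leaves
  only cos^2 + sin^2 = 1 and cancelling mixed terms.\<close>

lemma givens_orthogonal:
  assumes "i < N" "j < N" "i \<noteq> j"
  shows "transpose_mat (givens_rotation N i j t) * givens_rotation N i j t = 1\<^sub>m N"
proof -
  have tr: "transpose_mat (givens_rotation N i j t) = givens_rotation N i j (- t)"
    using assms by (intro eq_matI) (auto simp: givens_rotation_def)
  have sc: "cos t * cos t + sin t * sin t = 1" "sin t * sin t + cos t * cos t = 1"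
    using sin_cos_squared_add[of t] by (simp_all add: power2_eq_square)
  show ?thesis unfolding tr
  proof (rule eq_matI)
    fix a b assume "a < dim_row (1\<^sub>m N :: real mat)" "b < dim_col (1\<^sub>m N :: real mat)"
    then have ab: "a < N" "b < N" by auto
    show "(givens_rotation N i j (- t) * givens_rotation N i j t) $$ (a, b) = 1\<^sub>m N $$ (a, b)"
      unfolding givens_mult_index[OF givens_carrier assms ab]
      using assms ab sc by (auto simp: givens_rotation_def)
  qed (auto simp: givens_rotation_def)
qed

lemma gram_orthogonal_mult:
  fixes G V :: "real mat"
  assumes G: "G \<in> carrier_mat N N" "transpose_mat G * G = 1\<^sub>m N" and V: "V \<in> carrier_mat N c"
  shows "transpose_mat (G * V) * (G * V) = transpose_mat V * V"
proof -
  have GT: "transpose_mat G \<in> carrier_mat N N" and VT: "transpose_mat V \<in> carrier_mat c N"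
    using G V by auto
  have "transpose_mat (G * V) * (G * V) = transpose_mat V * (transpose_mat G * (G * V))"
    using transpose_mult[OF G(1) V] assoc_mult_mat[OF VT GT mult_carrier_mat[OF G(1) V]] by simp
  also have "transpose_mat G * (G * V) = V"
    using assoc_mult_mat[OF GT G(1) V] G(2) V by simp
  finally show ?thesis .
qed

text \<open>Take t to be the polar angle of the point (r, z): with q its distance from the origin,
  cos t = r / q and sin t = z / q, and the rotated point is (q, 0). Positivity of r keeps q away
  from 0, and the positive sign of q is what preserves a positive diagonal.\<close>

lemma rotation_clearing:
  fixes r z :: real
  assumes "0 < r"
  obtains t where "0 < cos t * r + sin t * z" "cos t * z - sin t * r = 0"
proof -
  define q where "q = sqrt (r\<^sup>2 + z\<^sup>2)"
  have pos: "0 < r\<^sup>2 + z\<^sup>2" using assms by (simp add: add_pos_nonneg)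
  then have q: "0 < q" "q\<^sup>2 = r\<^sup>2 + z\<^sup>2" by (auto simp: q_def)
  have "(r / q)\<^sup>2 + (z / q)\<^sup>2 = (r\<^sup>2 + z\<^sup>2) / q\<^sup>2"
    by (simp add: power_divide add_divide_distrib)
  also have "\<dots> = 1" using q(1) by (simp flip: q(2))
  finally obtain t where t: "r / q = cos t" "z / q = sin t"
    using sincos_total_2pi by metis
  have "cos t * r + sin t * z = (r\<^sup>2 + z\<^sup>2) / q"
    by (simp add: t[symmetric] power2_eq_square add_divide_distrib)
  then have "0 < cos t * r + sin t * z" using q pos by simp
  then show ?thesis using that[of t] by (simp add: t[symmetric])
qed

section \<open>Triangularization by successive rotations and the updated Cholesky factor\<close>

lemma left_prod_carrier:
  "(\<And>i. i < k \<Longrightarrow> G i \<in> carrier_mat N N) \<Longrightarrow> left_prod N G k \<in> carrier_mat N N"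
  by (induction k) (auto intro: mult_carrier_mat)

lemma left_prod_cong:
  "(\<And>i. i < k \<Longrightarrow> G i = G' i) \<Longrightarrow> left_prod N G k = left_prod N G' k"
  by (induction k) auto

text \<open>Induction on the number k of rotations applied. The invariant is that the upper m rows
  stay triangular with positive diagonal, the first k entries of the last row (index
  \<open>m\<close>, counting from 0) are cleared, and the Gram matrix is that of W.\<close>

lemma givens_elimination:
  assumes W: "W \<in> carrier_mat (m + 1) m"
    and upper: "\<And>i j. i < m \<Longrightarrow> j < i \<Longrightarrow> W $$ (i, j) = 0"
    and diag: "\<And>i. i < m \<Longrightarrow> 0 < W $$ (i, i)"
    and "k \<le> m"
  shows "\<exists>G V. (\<forall>i<k. \<exists>t. G i = givens_rotation (m + 1) i m t)
    \<and> V = left_prod (m + 1) G k * W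
    \<and> (\<forall>i<m. \<forall>j<i. V $$ (i, j) = 0) \<and> (\<forall>i<m. 0 < V $$ (i, i)) \<and> (\<forall>j<k. V $$ (m, j) = 0)
    \<and> transpose_mat V * V = transpose_mat W * W"
  using \<open>k \<le> m\<close>
proof (induction k)
  case 0
  show ?case using W upper diag by auto
next
  case (Suc k)
  then obtain G V where G: "\<And>i. i < k \<Longrightarrow> \<exists>t. G i = givens_rotation (m + 1) i m t"
    and VG: "V = left_prod (m + 1) G k * W"
    and Vupper: "\<And>i j. i < m \<Longrightarrow> j < i \<Longrightarrow> V $$ (i, j) = 0"
    and Vdiag: "\<And>i. i < m \<Longrightarrow> 0 < V $$ (i, i)"
    and Vlast: "\<And>j. j < k \<Longrightarrow> V $$ (m, j) = 0"
    and gram: "transpose_mat V * V = transpose_mat W * W"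
    by (metis Suc_leD)
  have k: "k < m" using Suc.prems by simp
  have L: "left_prod (m + 1) G k \<in> carrier_mat (m + 1) (m + 1)"
    using G by (intro left_prod_carrier) (metis givens_carrier)
  have V: "V \<in> carrier_mat (m + 1) m" using L W by (auto simp: VG)
  \<comment> \<open>The next angle sends the pair of entries in column k, rows k and m, to
    (positive, 0).\<close>
  obtain t where t: "0 < cos t * V $$ (k, k) + sin t * V $$ (m, k)"
    "cos t * V $$ (m, k) - sin t * V $$ (k, k) = 0"
    using rotation_clearing[OF Vdiag[OF k]] .
  define g where "g = givens_rotation (m + 1) k m t"
  have g: "g \<in> carrier_mat (m + 1) (m + 1)" by (simp add: g_def)
  have gV: "(g * V) $$ (a, b) =
    (if a = k then cos t * V $$ (k, b) + sin t * V $$ (m, b)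
     else if a = m then cos t * V $$ (m, b) - sin t * V $$ (k, b)
     else V $$ (a, b))" if "a < m + 1" "b < m" for a b
    unfolding g_def using k that by (intro givens_mult_index[OF V]) auto
  \<comment> \<open>Factor k does not occur among the first k factors, so choosing it now leaves the
    earlier product unchanged.\<close>
  have lp: "left_prod (m + 1) (G(k := g)) k = left_prod (m + 1) G k"
    by (rule left_prod_cong) simp
  show ?case
  proof (intro exI conjI)
    show "\<forall>i<Suc k. \<exists>t. (G(k := g)) i = givens_rotation (m + 1) i m t"
      using G by (auto simp: g_def less_Suc_eq)
    show "g * V = left_prod (m + 1) (G(k := g)) (Suc k) * W"
      unfolding left_prod.simps lp VG fun_upd_same by (rule assoc_mult_mat[OF g L W, symmetric])
    \<comment> \<open>No fill-in: only row k changes among the upper rows, and in each column before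
      k it combines two zeros, one from triangularity and one already cleared in the last
      row.\<close>
    show "\<forall>i<m. \<forall>j<i. (g * V) $$ (i, j) = 0"
      using k Vupper Vlast by (auto simp: gV)
    show "\<forall>i<m. 0 < (g * V) $$ (i, i)"
      using k Vdiag t by (auto simp: gV)
    \<comment> \<open>Columns before k again combine zeros; column k is cleared by the choice of
      t.\<close>
    show "\<forall>j<Suc k. (g * V) $$ (m, j) = 0"
      using k Vupper Vlast t by (auto simp: gV less_Suc_eq)
    show "transpose_mat (g * V) * (g * V) = transpose_mat W * W"
      using gram_orthogonal_mult[OF g _ V] givens_orthogonal[of k "m + 1" m t] k gram
      by (simp add: g_def)
  qed
qed

text \<open>Stacking x^T under R adds x x^T to the Gram matrix. After all m rotations the last row
  is zero, so the upper block alone carries this Gram matrix, and the invariant of the elimination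
  makes it a Cholesky factor.\<close>

lemma cholesky_update:
  assumes chol: "is_cholesky m S R" and x: "x \<in> carrier_vec m"
  shows "\<exists>G U R'. (\<forall>i<m. \<exists>t. G i = givens_rotation (m + 1) i m t)
    \<and> U = left_prod (m + 1) G m
    \<and> is_cholesky m (S + mat_of_cols m [x] * mat_of_row x) R'
    \<and> U * (R @\<^sub>r mat_of_row x) = R' @\<^sub>r 0\<^sub>m 1 m
    \<and> R' = submatrix U {..<m} {..<m + 1} * (R @\<^sub>r mat_of_row x)"
proof -
  have R: "R \<in> carrier_mat m m" and ut: "\<And>i j. i < m \<Longrightarrow> j < i \<Longrightarrow> R $$ (i, j) = 0"
    and d: "\<And>i. i < m \<Longrightarrow> 0 < R $$ (i, i)" and S: "S = transpose_mat R * R"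
    using chol by (auto simp: is_cholesky_def upper_triangular_def)
  have xr: "mat_of_row x \<in> carrier_mat 1 m" using x by auto
  define W where "W = R @\<^sub>r mat_of_row x"
  have W: "W \<in> carrier_mat (m + 1) m" unfolding W_def using R xr by (rule carrier_append_rows)
  have WW: "transpose_mat W * W = S + mat_of_cols m [x] * mat_of_row x"
    unfolding W_def S transpose_append_rows_mult[OF R xr R xr] transpose_mat_of_row[OF x] ..
  have WR: "W $$ (i, j) = R $$ (i, j)" if "i < m" "j < m" for i j
    unfolding W_def using append_rows_index[OF R xr, of i j] that by simp
  have "W $$ (i, j) = 0" if "i < m" "j < i" for i j using that ut by (simp add: WR)
  moreover have "0 < W $$ (i, i)" if "i < m" for i using that d by (simp add: WR)
  ultimately obtain G V where G: "\<And>i. i < m \<Longrightarrow> \<exists>t. G i = givens_rotation (m + 1) i m t"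
    and VG: "V = left_prod (m + 1) G m * W"
    and Vupper: "\<And>i j. i < m \<Longrightarrow> j < i \<Longrightarrow> V $$ (i, j) = 0"
    and Vdiag: "\<And>i. i < m \<Longrightarrow> 0 < V $$ (i, i)"
    and Vlast: "\<And>j. j < m \<Longrightarrow> V $$ (m, j) = 0"
    and gram: "transpose_mat V * V = transpose_mat W * W"
    using givens_elimination[OF W _ _ order_refl] by metis
  define U where "U = left_prod (m + 1) G m"
  have U: "U \<in> carrier_mat (m + 1) (m + 1)"
    unfolding U_def using G by (intro left_prod_carrier) (metis givens_carrier)
  have V: "V \<in> carrier_mat (m + 1) m" using U W by (auto simp: VG U_def)
  \<comment> \<open>The upper m by m block of the eliminated matrix.\<close>
  define R' where "R' = mat m m (\<lambda>(i, j). V $$ (i, j))"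
  have R': "R' \<in> carrier_mat m m" by (simp add: R'_def)
  have Z: "(0\<^sub>m 1 m :: real mat) \<in> carrier_mat 1 m" by simp
  have VR: "V = R' @\<^sub>r 0\<^sub>m 1 m"
  proof (rule eq_matI)
    have c: "R' @\<^sub>r 0\<^sub>m 1 m \<in> carrier_mat (m + 1) m" using R' Z by (rule carrier_append_rows)
    then show "dim_row V = dim_row (R' @\<^sub>r 0\<^sub>m 1 m)" "dim_col V = dim_col (R' @\<^sub>r 0\<^sub>m 1 m)"
      using V by auto
    fix i j assume "i < dim_row (R' @\<^sub>r 0\<^sub>m 1 m)" "j < dim_col (R' @\<^sub>r 0\<^sub>m 1 m)"
    then have ij: "i < m + 1" "j < m" using c by auto
    show "V $$ (i, j) = (R' @\<^sub>r 0\<^sub>m 1 m) $$ (i, j)"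
      unfolding append_rows_index[OF R' Z ij] using ij
      by (auto simp: R'_def Vlast less_Suc_eq)
  qed
  have "transpose_mat R' * R' = transpose_mat V * V"
    unfolding VR transpose_append_rows_mult[OF R' Z R' Z] using R' by simp
  then have "is_cholesky m (S + mat_of_cols m [x] * mat_of_row x) R'"
    using Vupper Vdiag R' by (simp add: is_cholesky_def upper_triangular_def R'_def gram WW)
  moreover have "R' = submatrix U {..<m} {..<m + 1} * W"
  proof (rule eq_matI)
    have "{i. i < m + 1 \<and> i \<in> {..<m}} = {..<m}" by auto
    then show "dim_row R' = dim_row (submatrix U {..<m} {..<m + 1} * W)"
      using U R' by (simp add: dim_submatrix)
    show "dim_col R' = dim_col (submatrix U {..<m} {..<m + 1} * W)" using W R' by simp
    then show "R' $$ (i, j) = (submatrix U {..<m} {..<m + 1} * W) $$ (i, j)"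
      if "i < dim_row (submatrix U {..<m} {..<m + 1} * W)"
        "j < dim_col (submatrix U {..<m} {..<m + 1} * W)" for i j
      using that R' W \<open>dim_row R' = _\<close> submatrix_leading_mult_index[OF U W, of m i j]
      by (simp add: R'_def VG U_def)
  qed
  ultimately show ?thesis
    using G VG VR unfolding U_def W_def by metis
qed

section \<open>The rank-one update\<close>

text \<open>A Sherman-Morrison argument phrased without inverses. Symmetry of S and S p = x give p^T
  (S + x x^T) = (1 + x . p) x^T, so the correction contributes (y - A x) x^T. Since A (S + x x^T) =
  A S + (A x) x^T, the A x terms cancel.\<close>

lemma rank_one_update_solves:
  fixes S A :: "real mat"
  assumes S: "S \<in> carrier_mat m m" "transpose_mat S = S" and A: "A \<in> carrier_mat l m"
    and x: "x \<in> carrier_vec m" and y: "y \<in> carrier_vec l" and p: "p \<in> carrier_vec m"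
    and Sp: "S *\<^sub>v p = x" and nz: "1 + x \<bullet> p \<noteq> 0"
  shows "(A + (1 / (1 + x \<bullet> p)) \<cdot>\<^sub>m (mat_of_cols l [y - A *\<^sub>v x] * mat_of_row p))
      * (S + mat_of_cols m [x] * mat_of_row x)
    = A * S + mat_of_cols l [y] * mat_of_row x"
    (is "(A + ?g \<cdot>\<^sub>m (?e * ?p)) * (S + ?x * ?xT) = _")
proof -
  let ?T = "S + ?x * ?xT"
  have c: "?e \<in> carrier_mat l 1" "?p \<in> carrier_mat 1 m" "?x \<in> carrier_mat m 1"
    "?xT \<in> carrier_mat 1 m" "?T \<in> carrier_mat m m"
    using p x S by auto
  have pT: "?p * ?T = (1 + x \<bullet> p) \<cdot>\<^sub>m ?xT"
  proof (rule eq_matI)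
    fix i j assume "i < dim_row ((1 + x \<bullet> p) \<cdot>\<^sub>m ?xT)" "j < dim_col ((1 + x \<bullet> p) \<cdot>\<^sub>m ?xT)"
    then have ij: "i = 0" "j < m" using x by auto
    \<comment> \<open>By symmetry, p against column j of S is entry j of S p, that is, of x.\<close>
    have "col S j = row S j" using S ij by (metis row_transpose carrier_matD)
    then have 1: "p \<bullet> col S j = x $ j"
      using ij S p by (simp flip: Sp) (metis comm_scalar_prod row_carrier_vec)
    have 2: "col (?x * ?xT) j = x $ j \<cdot>\<^sub>v x"
      by (rule eq_vecI) (use ij x in \<open>auto simp: scalar_prod_def mat_of_cols_index\<close>)
    have "(?p * ?T) $$ (i, j) = p \<bullet> col ?T j"
    proof -
      have "row ?p i = p" using p ij by (intro eq_vecI) auto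
      then show ?thesis using index_mult_mat(1)[of i ?p j ?T] carrier_matD[OF c(5)] ij by simp
    qed
    also have "col ?T j = col S j + col (?x * ?xT) j"
      using ij S c by (intro col_add) auto
    also have "p \<bullet> \<dots> = x $ j + x $ j * (x \<bullet> p)"
      unfolding 2 using S p x 1 ij
      by (subst scalar_prod_add_distrib[of _ m]) (auto simp: comm_scalar_prod[of p m x])
    finally show "(?p * ?T) $$ (i, j) = ((1 + x \<bullet> p) \<cdot>\<^sub>m ?xT) $$ (i, j)"
      using ij x by (simp add: algebra_simps)
  qed (use c in auto)
  have "?e * ?p * ?T = (1 + x \<bullet> p) \<cdot>\<^sub>m (?e * ?xT)"
    unfolding assoc_mult_mat[OF c(1,2,5)] pT by (rule mult_smult_distrib[OF c(1,4)])
  then have 1: "(?g \<cdot>\<^sub>m (?e * ?p)) * ?T = ?e * ?xT"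
    unfolding mult_smult_assoc_mat[OF mult_carrier_mat[OF c(1,2)] c(5)]
    by (intro eq_matI) (use nz in simp_all)
  have Ax: "A * ?x = mat_of_cols l [A *\<^sub>v x]"
    using A x by (intro eq_matI) (auto simp: mat_of_cols_index)
  have 2: "A * ?T = A * S + mat_of_cols l [A *\<^sub>v x] * ?xT"
    using A S c by (simp add: mult_add_distrib_mat[of A l m S m] Ax flip: assoc_mult_mat[of A l m ?x 1 ?xT m])
  have "(A + ?g \<cdot>\<^sub>m (?e * ?p)) * ?T = A * ?T + (?g \<cdot>\<^sub>m (?e * ?p)) * ?T"
    using A c by (intro add_mult_distrib_mat[of _ l m]) auto
  also have "\<dots> = A * S + mat_of_cols l [y] * ?xT"
    unfolding 1 2 using A S x y
    by (intro eq_matI) (auto simp: scalar_prod_def mat_of_cols_index left_diff_distrib)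
  finally show ?thesis .
qed


text \<open>The conclusions on invertibility and on
  \<open>1 + x\<^sub>n\<^sub>e\<^sub>w \<bullet> p\<^sub>x\<close> certify that \<open>minv\<close>
  and the division in \<open>\<gamma>\<close> have their intended meaning, both operations being
  total. Coordinates count from 0, so \<open>i\<close> and \<open>m\<close> stand for the
  coordinates i + 1 and m + 1 of the usual numbering.\<close>

theorem proposition5p3:
  fixes m n :: nat
    and X Y R\<^sub>x A X\<^sub>n\<^sub>e\<^sub>w Y\<^sub>n\<^sub>e\<^sub>w A\<^sub>n\<^sub>e\<^sub>w :: "real mat"
    and x\<^sub>n\<^sub>e\<^sub>w y\<^sub>n\<^sub>e\<^sub>w p\<^sub>x :: "real vec"
    and \<gamma> :: real
  assumes X: "X \<in> carrier_mat m n"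
    and Y: "Y \<in> carrier_mat m n"
    and full_row_rank: "vec_space.rank m X = m"
    and R: "is_cholesky m (X * transpose_mat X) R\<^sub>x"
    and A: "A = Y * pinverse X"
    and x: "x\<^sub>n\<^sub>e\<^sub>w \<in> carrier_vec m"
    and y: "y\<^sub>n\<^sub>e\<^sub>w \<in> carrier_vec m"
    and Xnew: "X\<^sub>n\<^sub>e\<^sub>w = append_col X x\<^sub>n\<^sub>e\<^sub>w"
    and Ynew: "Y\<^sub>n\<^sub>e\<^sub>w = append_col Y y\<^sub>n\<^sub>e\<^sub>w"
    and Anew: "A\<^sub>n\<^sub>e\<^sub>w = Y\<^sub>n\<^sub>e\<^sub>w * pinverse X\<^sub>n\<^sub>e\<^sub>w"
    and p: "p\<^sub>x = minv R\<^sub>x *\<^sub>v (minv (transpose_mat R\<^sub>x) *\<^sub>v x\<^sub>n\<^sub>e\<^sub>w)"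
    and gamma: "\<gamma> = 1 / (1 + x\<^sub>n\<^sub>e\<^sub>w \<bullet> p\<^sub>x)"
  shows "invertible_mat (X * transpose_mat X)
    \<and> A = (Y * transpose_mat X) * minv (X * transpose_mat X)
    \<and> invertible_mat R\<^sub>x
    \<and> 1 + x\<^sub>n\<^sub>e\<^sub>w \<bullet> p\<^sub>x \<noteq> 0
    \<and> A\<^sub>n\<^sub>e\<^sub>w = A + \<gamma> \<cdot>\<^sub>m (mat_of_cols m [y\<^sub>n\<^sub>e\<^sub>w - A *\<^sub>v x\<^sub>n\<^sub>e\<^sub>w] * mat_of_row p\<^sub>x)
    \<and> (\<exists>G U\<^sub>G R\<^sub>x\<^sub>n\<^sub>e\<^sub>w.
          (\<forall>i<m. \<exists>t. G i = givens_rotation (m + 1) i m t)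
        \<and> U\<^sub>G = left_prod (m + 1) G m
        \<and> is_cholesky m (X\<^sub>n\<^sub>e\<^sub>w * transpose_mat X\<^sub>n\<^sub>e\<^sub>w) R\<^sub>x\<^sub>n\<^sub>e\<^sub>w
        \<and> U\<^sub>G * (R\<^sub>x @\<^sub>r mat_of_row x\<^sub>n\<^sub>e\<^sub>w) = R\<^sub>x\<^sub>n\<^sub>e\<^sub>w @\<^sub>r 0\<^sub>m 1 m
        \<and> R\<^sub>x\<^sub>n\<^sub>e\<^sub>w = submatrix U\<^sub>G {..<m} {..<m + 1} * (R\<^sub>x @\<^sub>r mat_of_row x\<^sub>n\<^sub>e\<^sub>w))"
proof -
  let ?S = "X * transpose_mat X" and ?xx = "mat_of_cols m [x\<^sub>n\<^sub>e\<^sub>w] * mat_of_row x\<^sub>n\<^sub>e\<^sub>w"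
  have Rc: "R\<^sub>x \<in> carrier_mat m m" using R by (simp add: is_cholesky_def)
  have S: "?S \<in> carrier_mat m m" "transpose_mat ?S = ?S" using X by (auto simp: transpose_mult)
  obtain B where B: "B \<in> carrier_mat m m" and RB: "R\<^sub>x * B = 1\<^sub>m m" and BR: "B * R\<^sub>x = 1\<^sub>m m"
    using cholesky_inverse[OF R] .
  have BT: "transpose_mat B \<in> carrier_mat m m" using B by simp
  let ?C = "B * transpose_mat B"
  have C: "?C \<in> carrier_mat m m" using B by simp
  have SC: "?S * ?C = 1\<^sub>m m" using cholesky_gram_inverse[OF R B RB] .
  have A': "A = (Y * transpose_mat X) * ?C"
    unfolding A pinverse_full_row_rank[OF X C SC] using X Y C
    by (intro assoc_mult_mat[symmetric]) auto
  then have Ac: "A \<in> carrier_mat m m" using X Y C by auto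
  \<comment> \<open>Multiplying by the inverse Gram matrix is undone, which puts A in the form of a
    solution of a linear equation, as the rank-one update requires.\<close>
  have AS: "A * ?S = Y * transpose_mat X"
    unfolding A' using assoc_mult_mat[of "Y * transpose_mat X" m m ?C m ?S m] X Y C S
      mat_mult_left_right_inverse[OF S(1) C SC] by simp
  have "transpose_mat R\<^sub>x * transpose_mat B = 1\<^sub>m m"
    using transpose_mult[OF B Rc] BR by simp
  then have p': "p\<^sub>x = B *\<^sub>v (transpose_mat B *\<^sub>v x\<^sub>n\<^sub>e\<^sub>w)"
    unfolding p using minv_eqI[OF Rc B RB] minv_eqI[of "transpose_mat R\<^sub>x" m "transpose_mat B"] Rc BT
    by simp
  have pC: "p\<^sub>x = ?C *\<^sub>v x\<^sub>n\<^sub>e\<^sub>w"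
    unfolding p' using assoc_mult_mat_vec[OF B BT x] by simp
  then have pc: "p\<^sub>x \<in> carrier_vec m" using C x by (auto intro: mult_mat_vec_carrier)
  \<comment> \<open>The two triangular solves together amount to applying the inverse Gram matrix B
    B^T.\<close>
  have Sp: "?S *\<^sub>v p\<^sub>x = x\<^sub>n\<^sub>e\<^sub>w"
    unfolding pC using assoc_mult_mat_vec[OF S(1) C x] SC x by simp
  \<comment> \<open>The scalar x . p is the squared norm of B^T x, hence nonnegative, so adding 1
    cannot give 0.\<close>
  have "x\<^sub>n\<^sub>e\<^sub>w \<bullet> p\<^sub>x = (transpose_mat B *\<^sub>v x\<^sub>n\<^sub>e\<^sub>w) \<bullet> (transpose_mat B *\<^sub>v x\<^sub>n\<^sub>e\<^sub>w)"
    unfolding p' using transpose_vec_mult_scalar[OF B _ x, of "transpose_mat B *\<^sub>v x\<^sub>n\<^sub>e\<^sub>w"] BT x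
    by simp
  then have nz: "1 + x\<^sub>n\<^sub>e\<^sub>w \<bullet> p\<^sub>x \<noteq> 0"
    by (simp add: scalar_prod_def sum_nonneg add_nonneg_eq_0_iff)
  let ?A' = "A + \<gamma> \<cdot>\<^sub>m (mat_of_cols m [y\<^sub>n\<^sub>e\<^sub>w - A *\<^sub>v x\<^sub>n\<^sub>e\<^sub>w] * mat_of_row p\<^sub>x)"
  have A'c: "?A' \<in> carrier_mat m m"
    using Ac pc mult_carrier_mat[OF mat_of_cols_carrier(1)[of m "[y\<^sub>n\<^sub>e\<^sub>w - A *\<^sub>v x\<^sub>n\<^sub>e\<^sub>w]"], of "mat_of_row p\<^sub>x" m]
    by auto
  have Xc: "X\<^sub>n\<^sub>e\<^sub>w \<in> carrier_mat m (n + 1)" and Yc: "Y\<^sub>n\<^sub>e\<^sub>w \<in> carrier_mat m (n + 1)"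
    using X Y by (auto simp: Xnew Ynew append_col_def)
  have S': "X\<^sub>n\<^sub>e\<^sub>w * transpose_mat X\<^sub>n\<^sub>e\<^sub>w = ?S + ?xx"
    unfolding Xnew by (rule append_col_mult_transpose[OF X x X x])
  have AS': "?A' * (X\<^sub>n\<^sub>e\<^sub>w * transpose_mat X\<^sub>n\<^sub>e\<^sub>w) = Y\<^sub>n\<^sub>e\<^sub>w * transpose_mat X\<^sub>n\<^sub>e\<^sub>w"
    unfolding S' gamma rank_one_update_solves[OF S Ac x y pc Sp nz] AS
    unfolding Xnew Ynew by (rule append_col_mult_transpose[OF Y y X x, symmetric])
  have upd: "\<exists>G U\<^sub>G R\<^sub>x\<^sub>n\<^sub>e\<^sub>w. (\<forall>i<m. \<exists>t. G i = givens_rotation (m + 1) i m t)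
      \<and> U\<^sub>G = left_prod (m + 1) G m
      \<and> is_cholesky m (X\<^sub>n\<^sub>e\<^sub>w * transpose_mat X\<^sub>n\<^sub>e\<^sub>w) R\<^sub>x\<^sub>n\<^sub>e\<^sub>w
      \<and> U\<^sub>G * (R\<^sub>x @\<^sub>r mat_of_row x\<^sub>n\<^sub>e\<^sub>w) = R\<^sub>x\<^sub>n\<^sub>e\<^sub>w @\<^sub>r 0\<^sub>m 1 m
      \<and> R\<^sub>x\<^sub>n\<^sub>e\<^sub>w = submatrix U\<^sub>G {..<m} {..<m + 1} * (R\<^sub>x @\<^sub>r mat_of_row x\<^sub>n\<^sub>e\<^sub>w)"
    unfolding S' by (rule cholesky_update[OF R x])
  \<comment> \<open>The updated factor provides an inverse of the new Gram matrix, so the explicit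
    pseudoinverse formula applies to \<open>X\<^sub>n\<^sub>e\<^sub>w\<close>.\<close>
  then obtain R' where R': "is_cholesky m (X\<^sub>n\<^sub>e\<^sub>w * transpose_mat X\<^sub>n\<^sub>e\<^sub>w) R'" by blast
  obtain B' where B': "B' \<in> carrier_mat m m" "R' * B' = 1\<^sub>m m" using cholesky_inverse[OF R'] .
  let ?C' = "B' * transpose_mat B'"
  have C': "?C' \<in> carrier_mat m m" using B' by simp
  have SC': "X\<^sub>n\<^sub>e\<^sub>w * transpose_mat X\<^sub>n\<^sub>e\<^sub>w * ?C' = 1\<^sub>m m" using cholesky_gram_inverse[OF R' B'] .
  have "A\<^sub>n\<^sub>e\<^sub>w = Y\<^sub>n\<^sub>e\<^sub>w * transpose_mat X\<^sub>n\<^sub>e\<^sub>w * ?C'"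
    unfolding Anew pinverse_full_row_rank[OF Xc C' SC'] using Xc Yc C'
    by (intro assoc_mult_mat[symmetric]) auto
  \<comment> \<open>Both matrices solve the same equation with the new Gram matrix, which is now
    cancelled on the right.\<close>
  also have "\<dots> = ?A' * (X\<^sub>n\<^sub>e\<^sub>w * transpose_mat X\<^sub>n\<^sub>e\<^sub>w * ?C')"
    unfolding AS'[symmetric] using A'c Xc C' by (intro assoc_mult_mat) auto
  also have "\<dots> = ?A'" unfolding SC' using A'c by (rule right_mult_one_mat)
  finally show ?thesis
    using upd nz invertible_matI[OF S(1) C SC] invertible_matI[OF Rc B RB]
      minv_eqI[OF S(1) C SC] A' by simp
qed

end
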